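(* Let $\nu,d\in\mathbb{C}$ with $|\nu|\le 1$ and let $\Phi(z)=\nu z+d$ for all $z\in\mathbb{C}$ be such that the composition operator $C_\Phi$ is bounded on $H_E(\zeta)$. Then $C_\Phi$ is self-adjoint if and only if $d=0$ and $\nu$ is a real number.
   Context: Let $\mathbb{N}_0=\mathbb{N}\cup\{0\}$ and let $\zeta=(\zeta_n)_{n\in\mathbb{N}_0}$ be a sequence of positive real numbers with $\lim_{n\to\infty}\zeta_n^{1/n}=\infty$. The weighted Hardy space of entire functions induced by $\zeta$ is the Hilbert space $H_E(\zeta)=\{g(z)=\sum_{n=0}^\infty b_nz^n : \|g\|^2=\sum_{n=0}^\infty |b_n|^2\zeta_n^2<\infty\}$ of entire functions on $\mathbb{C}$, with inner product $\langle g,h\rangle=\sum_{n=0}^\infty b_n\overline{c_n}\zeta_n^2$ for $g(z)=\sum b_nz^n$ and $h(z)=\sum c_nz^n$ in $H_E(\zeta)$. For an entire function $\Phi:\mathbb{C}\to\mathbb{C}$, the composition operator is $C_\Phi f=f\circ\Phi$; it is bounded on $H_E(\zeta)$ if it maps $H_E(\zeta)$ into itself as a bounded linear operator. *)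

theory Defs
  imports "HOL-Complex_Analysis.Complex_Analysis"
begin

definition taylor_coeff :: "(complex \<Rightarrow> complex) \<Rightarrow> nat \<Rightarrow> complex" where
  "taylor_coeff g n = fps_nth (fps_expansion g 0) n"

(* zeta_n^(1/n) is written with root; the value at n = 0 does not affect the limit. *)
definition weight_sequence :: "(nat \<Rightarrow> real) \<Rightarrow> bool" where
  "weight_sequence \<zeta> \<longleftrightarrow>
     (\<forall>n. \<zeta> n > 0) \<and> filterlim (\<lambda>n. root n (\<zeta> n)) at_top sequentially"

definition H_E :: "(nat \<Rightarrow> real) \<Rightarrow> (complex \<Rightarrow> complex) set" where
  "H_E \<zeta> = {g. g holomorphic_on UNIV \<and>
                summable (\<lambda>n. (cmod (taylor_coeff g n))\<^sup>2 * (\<zeta> n)\<^sup>2)}"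

(* For g and h in H_E the series converges absolutely, by the Cauchy-Schwarz inequality. *)
definition H_inner ::
    "(nat \<Rightarrow> real) \<Rightarrow> (complex \<Rightarrow> complex) \<Rightarrow> (complex \<Rightarrow> complex) \<Rightarrow> complex" where
  "H_inner \<zeta> g h =
     (\<Sum>n. taylor_coeff g n * cnj (taylor_coeff h n) * complex_of_real ((\<zeta> n)\<^sup>2))"

definition H_norm :: "(nat \<Rightarrow> real) \<Rightarrow> (complex \<Rightarrow> complex) \<Rightarrow> real" where
  "H_norm \<zeta> g = sqrt (\<Sum>n. (cmod (taylor_coeff g n))\<^sup>2 * (\<zeta> n)\<^sup>2)"

(* Operators are total functions on complex functions; only their restriction to H_E matters
   in what follows. *)
definition bounded_operator ::
    "(nat \<Rightarrow> real) \<Rightarrow> ((complex \<Rightarrow> complex) \<Rightarrow> complex \<Rightarrow> complex) \<Rightarrow> bool" where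
  "bounded_operator \<zeta> T \<longleftrightarrow>
     (\<forall>f\<in>H_E \<zeta>. T f \<in> H_E \<zeta>) \<and>
     (\<forall>f\<in>H_E \<zeta>. \<forall>g\<in>H_E \<zeta>. T (\<lambda>z. f z + g z) = (\<lambda>z. T f z + T g z)) \<and>
     (\<forall>c. \<forall>f\<in>H_E \<zeta>. T (\<lambda>z. c * f z) = (\<lambda>z. c * T f z)) \<and>
     (\<exists>M. \<forall>f\<in>H_E \<zeta>. H_norm \<zeta> (T f) \<le> M * H_norm \<zeta> f)"

(* S is the Hilbert space adjoint of T; this determines S on H_E. *)
definition is_adjoint ::
    "(nat \<Rightarrow> real) \<Rightarrow> ((complex \<Rightarrow> complex) \<Rightarrow> complex \<Rightarrow> complex) \<Rightarrow>
     ((complex \<Rightarrow> complex) \<Rightarrow> complex \<Rightarrow> complex) \<Rightarrow> bool" where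
  "is_adjoint \<zeta> T S \<longleftrightarrow> bounded_operator \<zeta> T \<and> bounded_operator \<zeta> S \<and>
     (\<forall>f\<in>H_E \<zeta>. \<forall>g\<in>H_E \<zeta>. H_inner \<zeta> (T f) g = H_inner \<zeta> f (S g))"

definition self_adjoint ::
    "(nat \<Rightarrow> real) \<Rightarrow> ((complex \<Rightarrow> complex) \<Rightarrow> complex \<Rightarrow> complex) \<Rightarrow> bool" where
  "self_adjoint \<zeta> T \<longleftrightarrow> is_adjoint \<zeta> T T"

definition composition_operator ::
    "(complex \<Rightarrow> complex) \<Rightarrow> (complex \<Rightarrow> complex) \<Rightarrow> complex \<Rightarrow> complex" where
  "composition_operator \<Phi> f = f \<circ> \<Phi>"

end

theory Submission
  imports Defs
begin

text \<open>Affine symbols preserve the span of 1 and z, and self-adjointness is already decisive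
  there. In the orthogonal basis 1, z, comparing the pairings of C z with 1 and of z with C 1 forces
  d = 0, and the diagonal entry at z forces \<nu> to be real (\<open>H_inner_affine\<close>).
  Conversely, for d = 0 the operator is f(z) to f(\<nu> z), which multiplies the n-th Taylor
  coefficient by \<nu>^n (\<open>taylor_coeff_compose_mult\<close>): a diagonal operator, symmetric
  when \<nu> is real.\<close>

lemma taylor_coeff_eqI:
  assumes "g has_fps_expansion G"
  shows "taylor_coeff g n = fps_nth G n"
  unfolding taylor_coeff_def fps_expansion_eqI[OF assms] ..

lemma taylor_coeff_affine:
  "taylor_coeff (\<lambda>z. a * z + b) n = (if n = 0 then b else if n = 1 then a else 0)"
proof -
  have "(\<lambda>z. a * z + b) has_fps_expansion (fps_const a * fps_X + fps_const b)"
    by (intro fps_expansion_intros)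
  then show ?thesis
    by (auto simp: taylor_coeff_eqI)
qed

text \<open>Substituting c X into the power series of g rescales each monomial separately; thus
  dilations are diagonal in the monomial basis.\<close>

lemma taylor_coeff_compose_mult:
  assumes "g holomorphic_on UNIV"
  shows "taylor_coeff (\<lambda>z. g (c * z)) n = c ^ n * taylor_coeff g n"
proof -
  have "g has_fps_expansion fps_expansion g 0"
    using assms by (intro has_fps_expansion_fps_expansion[of UNIV]) auto
  moreover have "(\<lambda>z. c * z) has_fps_expansion (fps_const c * fps_X)"
    by (intro fps_expansion_intros)
  ultimately have "(g \<circ> (\<lambda>z. c * z)) has_fps_expansion
      fps_compose (fps_expansion g 0) (fps_const c * fps_X)"
    by (rule has_fps_expansion_compose) simp
  then show ?thesis
    by (simp add: o_def taylor_coeff_eqI fps_compose_linear) (simp add: taylor_coeff_def)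
qed

text \<open>Only the coefficients of index 0 and 1 can be nonzero, so the norm series is a finite
  sum for any weight.\<close>

lemma affine_in_H_E: "(\<lambda>z. a * z + b) \<in> H_E \<zeta>"
proof -
  have "summable (\<lambda>n. (cmod (taylor_coeff (\<lambda>z. a * z + b) n))\<^sup>2 * (\<zeta> n)\<^sup>2)"
    by (rule summable_finite[of "{0, 1}"]) (auto simp: taylor_coeff_affine)
  then show ?thesis
    by (auto simp: H_E_def intro!: holomorphic_intros)
qed

lemma H_inner_affine:
  "H_inner \<zeta> (\<lambda>z. a * z + b) (\<lambda>z. a' * z + b') =
     b * cnj b' * (\<zeta> 0)\<^sup>2 + a * cnj a' * (\<zeta> 1)\<^sup>2"
  unfolding H_inner_def
  by (subst suminf_finite[of "{0, 1}"]) (auto simp: taylor_coeff_affine)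

theorem corollary2p2:
  fixes \<zeta> :: "nat \<Rightarrow> real" and \<nu> d :: complex and \<Phi> :: "complex \<Rightarrow> complex"
  assumes "weight_sequence \<zeta>"
    and "cmod \<nu> \<le> 1"
    and "\<And>z. \<Phi> z = \<nu> * z + d"
    and "bounded_operator \<zeta> (composition_operator \<Phi>)"
  shows "self_adjoint \<zeta> (composition_operator \<Phi>) \<longleftrightarrow> d = 0 \<and> \<nu> \<in> \<real>"
proof
  have pos: "\<zeta> n > 0" for n
    using assms(1) by (simp add: weight_sequence_def)
  assume "self_adjoint \<zeta> (composition_operator \<Phi>)"
  then have adj: "H_inner \<zeta> (f \<circ> \<Phi>) g = H_inner \<zeta> f (g \<circ> \<Phi>)"
    if "f \<in> H_E \<zeta>" "g \<in> H_E \<zeta>" for f g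
    using that by (simp add: self_adjoint_def is_adjoint_def composition_operator_def)
  have comp: "(\<lambda>z. a * z + b) \<circ> \<Phi> = (\<lambda>z. (a * \<nu>) * z + (a * d + b))" for a b
    by (auto simp: assms(3) algebra_simps)
  \<comment> \<open>Self-adjointness tested on two arbitrary affine functions; what follows only
    picks coefficients.\<close>
  have affine: "(a * d + b) * cnj b' * (\<zeta> 0)\<^sup>2 + (a * \<nu>) * cnj a' * (\<zeta> 1)\<^sup>2 =
      b * cnj (a' * d + b') * (\<zeta> 0)\<^sup>2 + a * cnj (a' * \<nu>) * (\<zeta> 1)\<^sup>2" for a b a' b'
    using adj[OF affine_in_H_E affine_in_H_E, of a b a' b'] unfolding comp H_inner_affine .
  \<comment> \<open>Test pair f = z, g = 1: as constants are fixed by composition, the identity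
    reads d \<zeta>(0)^2 = 0.\<close>
  have "d = 0"
    using affine[where a = 1 and b = 0 and a' = 0 and b' = 1] pos[of 0] by simp
  \<comment> \<open>Test pair f = g = z: the constant terms drop out, and \<zeta>(1)^2
    cancels.\<close>
  moreover have "cnj \<nu> = \<nu>"
    using affine[where a = 1 and b = 0 and a' = 1 and b' = 0] pos[of 1] by simp
  ultimately show "d = 0 \<and> \<nu> \<in> \<real>"
    by (simp add: Reals_cnj_iff)
next
  assume *: "d = 0 \<and> \<nu> \<in> \<real>"
  then have comp: "f \<circ> \<Phi> = (\<lambda>z. f (\<nu> * z))" for f :: "complex \<Rightarrow> complex"
    by (auto simp: assms(3))
  \<comment> \<open>The two series agree term by term: one carries the factor \<nu>^n, the other its
    conjugate, and these coincide for real \<nu>.\<close>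
  have "H_inner \<zeta> (f \<circ> \<Phi>) g = H_inner \<zeta> f (g \<circ> \<Phi>)" if "f \<in> H_E \<zeta>" "g \<in> H_E \<zeta>" for f g
    using that * unfolding comp H_inner_def
    by (simp add: H_E_def taylor_coeff_compose_mult Reals_cnj_iff) (simp add: mult_ac)
  then show "self_adjoint \<zeta> (composition_operator \<Phi>)"
    using assms(4) by (simp add: self_adjoint_def is_adjoint_def composition_operator_def)
qed

end
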